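(* Let $K$ be an algebraically closed field, $S=K[y_0,\dots,y_n]$, $\mathfrak M=(y_0,\dots,y_n)$. Let $\mathfrak I\subset S$ be a homogeneous perfect ideal of codimension $2$ with $\mathfrak I^{sat}\subsetneq\mathfrak M$, let $\mathcal B(\mathfrak I)$ be a standard basis of $\mathfrak I$, let $M(\mathfrak I)$ be a Hilbert matrix of $\mathfrak I$ with respect to $\mathcal B(\mathfrak I)$, let $f_r$ be the $r$-th element of $\mathcal B(\mathfrak I)$, and let $\mathfrak I_{C_r}\subset S$ be the ideal generated by the entries of the $r$-th column $C_r$ of $M(\mathfrak I)$. Then $f_r$ is inessential with respect to $\mathcal B(\mathfrak I)$ if and only if there exists $t\in\mathbb N$ such that $\mathfrak M^t\subseteq\mathfrak I_{C_r}$.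
   Context: For a homogeneous ideal $\mathfrak I$, $\mathfrak I^{sat}=\{f\in S:\ f\,\mathfrak M^t\subseteq\mathfrak I\text{ for some }t\in\mathbb N\}$. A standard basis of $\mathfrak I$ is an ordered set of forms generating $\mathfrak I$ such that, for each $d$, its elements of degree $d$ define a $K$-basis of $\mathfrak I_d/(\mathfrak I_{d-1}S_1)$. An element $f$ of a standard basis $\mathcal B$ is inessential with respect to $\mathcal B$ if $f\in\mathfrak H^{sat}$, where $\mathfrak H$ is the ideal generated by $\mathcal B\setminus\{f\}$; otherwise it is essential. Hilbert (Hilbert–Burch) matrix: if $\mathcal B(\mathfrak I)=(g_1,\dots,g_t)$ with $\deg g_j\le\deg g_{j+1}$, and $s_i=(a_{i1},\dots,a_{it})$, $i=1,\dots,t-1$, is a basis of the (free) module of syzygies of $(g_1,\dots,g_t)$ consisting of homogeneous syzygies ordered by degree, where $\deg s_i=\deg(a_{ij}g_j)$, then $M(\mathfrak I)=(a_{ij})$ is a $(t-1)\times t$ Hilbert matrix with respect to $\mathcal B(\mathfrak I)$; its $j$-th column $C_j$ is the column corresponding to $g_j$. *)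

theory Defs
  imports
    "HOL-Library.Poly_Mapping"
    "HOL-Library.Extended_Nat"
    "HOL-Library.FuncSet"
    "HOL-Computational_Algebra.Polynomial"
    "Jordan_Normal_Form.Matrix"
begin

section \<open>Ideals of a commutative ring\<close>

text \<open>A commutative ring is regarded as a module over itself, with scalar multiplication the
  ring multiplication; its submodules are the ideals.\<close>

definition is_ideal :: "'a::comm_ring_1 set \<Rightarrow> bool" where
  "is_ideal I \<longleftrightarrow> Modules.module.subspace (*) I"

definition ideal_gen :: "'a::comm_ring_1 set \<Rightarrow> 'a set" where
  "ideal_gen F = Modules.module.span (*) F"

definition is_prime_ideal :: "'a::comm_ring_1 set \<Rightarrow> bool" where
  "is_prime_ideal P \<longleftrightarrow> is_ideal P \<and> P \<noteq> UNIV \<and> (\<forall>a b. a * b \<in> P \<longrightarrow> a \<in> P \<or> b \<in> P)"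

primrec ideal_power :: "'a::comm_ring_1 set \<Rightarrow> nat \<Rightarrow> 'a set" where
  "ideal_power I 0 = UNIV"
| "ideal_power I (Suc t) = ideal_gen {a * b | a b. a \<in> I \<and> b \<in> ideal_power I t}"

definition prime_height :: "'a::comm_ring_1 set \<Rightarrow> enat" where
  "prime_height P = Sup {enat k | k. \<exists>Q :: nat \<Rightarrow> 'a set.
     Q k = P \<and> (\<forall>i\<le>k. is_prime_ideal (Q i)) \<and> (\<forall>i<k. Q i \<subset> Q (Suc i))}"

definition codimension :: "'a::comm_ring_1 set \<Rightarrow> enat" where
  "codimension I = Inf {prime_height P | P. is_prime_ideal P \<and> I \<subseteq> P}"

definition regular_sequence :: "'a::comm_ring_1 list \<Rightarrow> bool" where
  "regular_sequence xs \<longleftrightarrow>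
     (\<forall>i<length xs. \<forall>s. xs ! i * s \<in> ideal_gen (set (take i xs)) \<longrightarrow> s \<in> ideal_gen (set (take i xs)))
     \<and> ideal_gen (set xs) \<noteq> UNIV"

definition grade :: "'a::comm_ring_1 set \<Rightarrow> enat" where
  "grade I = Sup {enat (length xs) | xs. regular_sequence xs \<and> set xs \<subseteq> I}"

section \<open>Projective dimension of a cyclic module, perfect ideals\<close>

text \<open>The type \<open>nat \<Rightarrow>\<^sub>0 'a\<close> of finitely supported sequences is the free module of countable
  rank; the projective modules are taken among its direct summands. Over a Noetherian ring this
  is no restriction for resolving a finitely generated module: there is a resolution by finitely
  generated projectives, and one of minimal length.\<close>

definition free_scale :: "'a::comm_ring_1 \<Rightarrow> (nat \<Rightarrow>\<^sub>0 'a) \<Rightarrow> (nat \<Rightarrow>\<^sub>0 'a)" where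
  "free_scale s x = Poly_Mapping.map ((*) s) x"

definition projective_submodule :: "(nat \<Rightarrow>\<^sub>0 'a::comm_ring_1) set \<Rightarrow> bool" where
  "projective_submodule P \<longleftrightarrow> Modules.module.subspace free_scale P \<and>
     (\<exists>Q. Modules.module.subspace free_scale Q \<and> P \<inter> Q = {0} \<and> (\<forall>x. \<exists>p\<in>P. \<exists>q\<in>Q. x = p + q))"

definition linear_map_on ::
  "(nat \<Rightarrow>\<^sub>0 'a::comm_ring_1) set \<Rightarrow> ((nat \<Rightarrow>\<^sub>0 'a) \<Rightarrow> (nat \<Rightarrow>\<^sub>0 'a)) \<Rightarrow> bool" where
  "linear_map_on P h \<longleftrightarrow> (\<forall>x\<in>P. \<forall>y\<in>P. h (x + y) = h x + h y)
     \<and> (\<forall>s. \<forall>x\<in>P. h (free_scale s x) = free_scale s (h x))"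

text \<open>A module homomorphism from \<open>P\<close> to the quotient by \<open>I\<close>, given by a choice of
  representatives of its values.\<close>

definition linear_map_mod ::
  "'a::comm_ring_1 set \<Rightarrow> (nat \<Rightarrow>\<^sub>0 'a) set \<Rightarrow> ((nat \<Rightarrow>\<^sub>0 'a) \<Rightarrow> 'a) \<Rightarrow> bool" where
  "linear_map_mod I P e \<longleftrightarrow> (\<forall>x\<in>P. \<forall>y\<in>P. e (x + y) - (e x + e y) \<in> I)
     \<and> (\<forall>s. \<forall>x\<in>P. e (free_scale s x) - s * e x \<in> I)"

text \<open>Here \<open>\<delta> i\<close> maps \<open>P (Suc i)\<close> to \<open>P i\<close>, and \<open>e\<close> is the augmentation from \<open>P 0\<close> onto the
  quotient of the ring by \<open>I\<close>.\<close>

definition projective_resolution ::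
  "'a::comm_ring_1 set \<Rightarrow> (nat \<Rightarrow> (nat \<Rightarrow>\<^sub>0 'a) set) \<Rightarrow> (nat \<Rightarrow> (nat \<Rightarrow>\<^sub>0 'a) \<Rightarrow> (nat \<Rightarrow>\<^sub>0 'a))
     \<Rightarrow> ((nat \<Rightarrow>\<^sub>0 'a) \<Rightarrow> 'a) \<Rightarrow> bool" where
  "projective_resolution I P \<delta> e \<longleftrightarrow>
     (\<forall>i. projective_submodule (P i)) \<and>
     (\<forall>i. linear_map_on (P (Suc i)) (\<delta> i)) \<and>
     linear_map_mod I (P 0) e \<and>
     (\<forall>s. \<exists>x\<in>P 0. e x - s \<in> I) \<and>
     \<delta> 0 ` P (Suc 0) = {x \<in> P 0. e x \<in> I} \<and>
     (\<forall>i. \<delta> (Suc i) ` P (Suc (Suc i)) = {x \<in> P (Suc i). \<delta> i x = 0})"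

text \<open>The projective dimension of the quotient of the ring by \<open>I\<close> (\<open>\<infinity>\<close> if there is no finite
  resolution).\<close>

definition proj_dim_quotient :: "'a::comm_ring_1 set \<Rightarrow> enat" where
  "proj_dim_quotient I = Inf {enat d | d.
     \<exists>P \<delta> e. projective_resolution I P \<delta> e \<and> (\<forall>i>d. P i = {0})}"

definition perfect_ideal :: "'a::comm_ring_1 set \<Rightarrow> bool" where
  "perfect_ideal I \<longleftrightarrow> is_ideal I \<and> I \<noteq> UNIV \<and> proj_dim_quotient I = grade I"

section \<open>The graded polynomial ring\<close>

text \<open>Polynomials with coefficients in \<open>'k\<close> in variables indexed by the finite type \<open>'v\<close>; for
  \<open>y\<^sub>0, \<dots>, y\<^sub>n\<close> this type has \<open>n + 1\<close> elements.\<close>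

type_synonym ('v, 'k) mpoly = "('v \<Rightarrow>\<^sub>0 nat) \<Rightarrow>\<^sub>0 'k"

definition scalar_mult :: "'k::field \<Rightarrow> ('v::finite, 'k) mpoly \<Rightarrow> ('v, 'k) mpoly" where
  "scalar_mult c p = Poly_Mapping.single 0 c * p"

definition variable :: "'v::finite \<Rightarrow> ('v, 'k::field) mpoly" where
  "variable v = Poly_Mapping.single (Poly_Mapping.single v 1) 1"

definition monomial_degree :: "('v::finite \<Rightarrow>\<^sub>0 nat) \<Rightarrow> nat" where
  "monomial_degree m = (\<Sum>v\<in>UNIV. Poly_Mapping.lookup m v)"

text \<open>The zero polynomial is homogeneous of every degree.\<close>

definition homogeneous :: "nat \<Rightarrow> ('v::finite, 'k::field) mpoly \<Rightarrow> bool" where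
  "homogeneous d p \<longleftrightarrow> (\<forall>m\<in>Poly_Mapping.keys p. monomial_degree m = d)"

text \<open>Only applied to nonzero polynomials.\<close>

definition total_degree :: "('v::finite, 'k::field) mpoly \<Rightarrow> nat" where
  "total_degree p = Max (monomial_degree ` Poly_Mapping.keys p)"

definition homogeneous_ideal :: "('v::finite, 'k::field) mpoly set \<Rightarrow> bool" where
  "homogeneous_ideal I \<longleftrightarrow> (\<exists>F. (\<forall>f\<in>F. \<exists>d. homogeneous d f) \<and> I = ideal_gen F)"

definition irrelevant_ideal :: "('v::finite, 'k::field) mpoly set" where
  "irrelevant_ideal = ideal_gen (range variable)"

definition saturation :: "('v::finite, 'k::field) mpoly set \<Rightarrow> ('v, 'k) mpoly set" where
  "saturation I = {f. \<exists>t. \<forall>m\<in>ideal_power irrelevant_ideal t. f * m \<in> I}"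

section \<open>Standard bases and Hilbert matrices\<close>

text \<open>The subspace generated by the products of the forms of degree \<open>d - 1\<close> in \<open>I\<close> with the linear
  forms; it is \<open>{0}\<close> for \<open>d = 0\<close>.\<close>

definition lower_part :: "('v::finite, 'k::field) mpoly set \<Rightarrow> nat \<Rightarrow> ('v, 'k) mpoly set" where
  "lower_part I d = Modules.module.span scalar_mult
     {p * l | p l. \<exists>e. d = Suc e \<and> p \<in> I \<and> homogeneous e p \<and> homogeneous 1 l}"

text \<open>That the elements of degree \<open>d\<close> of \<open>B\<close> define a basis of the quotient of the degree \<open>d\<close> part
  of \<open>I\<close> by \<open>lower_part I d\<close> is expressed by existence and uniqueness of coordinates. In particular
  \<open>0\<close> is not an element of \<open>B\<close>.\<close>

definition standard_basis ::
  "('v::finite, 'k::field) mpoly set \<Rightarrow> ('v, 'k) mpoly list \<Rightarrow> bool" where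
  "standard_basis I B \<longleftrightarrow>
     distinct B \<and>
     (\<forall>g\<in>set B. \<exists>d. homogeneous d g) \<and>
     ideal_gen (set B) = I \<and>
     (\<forall>d. \<forall>f\<in>I. homogeneous d f \<longrightarrow>
        (\<exists>!c. c \<in> {g \<in> set B. homogeneous d g} \<rightarrow>\<^sub>E UNIV \<and>
           f - (\<Sum>g\<in>{g \<in> set B. homogeneous d g}. scalar_mult (c g) g) \<in> lower_part I d))"

definition inessential :: "('v::finite, 'k::field) mpoly list \<Rightarrow> ('v, 'k) mpoly \<Rightarrow> bool" where
  "inessential B f \<longleftrightarrow> f \<in> set B \<and> f \<in> saturation (ideal_gen (set B - {f}))"

definition syzygies :: "'a::comm_ring_1 list \<Rightarrow> 'a vec set" where
  "syzygies B = {s \<in> carrier_vec (length B). s \<bullet> vec_of_list B = 0}"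

text \<open>The elements of the list are nonzero in the intended use, so the entries of such a syzygy
  are forms, and the degree is unique if the syzygy is nonzero.\<close>

definition homogeneous_syzygy ::
  "nat \<Rightarrow> ('v::finite, 'k::field) mpoly list \<Rightarrow> ('v, 'k) mpoly vec \<Rightarrow> bool" where
  "homogeneous_syzygy d B s \<longleftrightarrow> s \<in> syzygies B \<and> (\<forall>j<length B. homogeneous d (s $ j * B ! j))"

text \<open>The rows of \<open>M\<close> form a basis of the module of syzygies: every syzygy is a unique
  linear combination of the rows.\<close>

definition hilbert_matrix ::
  "('v::finite, 'k::field) mpoly list \<Rightarrow> ('v, 'k) mpoly mat \<Rightarrow> bool" where
  "hilbert_matrix B M \<longleftrightarrow>
     sorted (map total_degree B) \<and>
     M \<in> carrier_mat (length B - 1) (length B) \<and>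
     (\<forall>i<dim_row M. row M i \<in> syzygies B) \<and>
     (\<forall>s\<in>syzygies B. \<exists>!c. c \<in> carrier_vec (dim_row M) \<and> transpose_mat M *\<^sub>v c = s) \<and>
     (\<exists>\<delta>. (\<forall>i<dim_row M. homogeneous_syzygy (\<delta> i) B (row M i)) \<and>
          (\<forall>i j. i \<le> j \<and> j < dim_row M \<longrightarrow> \<delta> i \<le> \<delta> j))"

definition column_ideal :: "'a::comm_ring_1 mat \<Rightarrow> nat \<Rightarrow> 'a set" where
  "column_ideal M r = ideal_gen (set\<^sub>v (col M r))"

end

theory Submission
  imports Defs
begin

text \<open>Write \<open>f\<close> for the \<open>r\<close>-th generator and \<open>H\<close> for the ideal generated by the others. A relation
  \<open>f * m = (\<Sum>j\<noteq>r. c j * g j)\<close> is the same thing as a syzygy of the generators with \<open>r\<close>-th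
  coordinate \<open>m\<close>, so the colon ideal \<open>(H : f)\<close> consists of the \<open>r\<close>-th coordinates of the syzygies
  (\<open>mult_mem_others_iff_syzygy_coordinate\<close>). The rows of a Hilbert matrix generate all syzygies;
  hence their \<open>r\<close>-th coordinates, the entries of the \<open>r\<close>-th column, generate the ideal of these
  coordinates (\<open>mem_column_ideal_iff_syzygy_coordinate\<close>). Thus \<open>(H : f)\<close> is the column ideal, and
  \<open>f\<close> lies in the saturation of \<open>H\<close> exactly when \<open>(H : f)\<close> contains a power of the irrelevant
  ideal.\<close>

interpretation ring_module: Modules.module "(*) :: 'a::comm_ring_1 \<Rightarrow> 'a \<Rightarrow> 'a"
  by unfold_locales (simp_all add: algebra_simps)

text \<open>The coefficients are indexed by \<open>A\<close> and not by the generators: a column of a matrix may have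
  equal entries, and the coefficient vector must then have one component for each row.\<close>

lemma ideal_gen_image_finite:
  fixes f :: "'i \<Rightarrow> 'a::comm_ring_1"
  assumes "finite A"
  shows "ideal_gen (f ` A) = range (\<lambda>c. \<Sum>i\<in>A. c i * f i)" (is "_ = ?R")
proof
  have "ring_module.subspace ?R"
  proof (rule ring_module.subspaceI)
    show "0 \<in> ?R" by (rule range_eqI[of _ _ "\<lambda>_. 0"]) simp
  next
    fix x y assume "x \<in> ?R" "y \<in> ?R"
    then obtain c d where "x = (\<Sum>i\<in>A. c i * f i)" "y = (\<Sum>i\<in>A. d i * f i)" by blast
    then show "x + y \<in> ?R"
      by (intro range_eqI[of _ _ "\<lambda>i. c i + d i"]) (simp add: sum.distrib distrib_right)
  next
    fix a x assume "x \<in> ?R"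
    then obtain c where "x = (\<Sum>i\<in>A. c i * f i)" by blast
    then have "a * x = (\<Sum>i\<in>A. (a * c i) * f i)"
      by (simp only: sum_distrib_left mult.assoc)
    then show "a * x \<in> ?R" by (rule range_eqI[of _ _ "\<lambda>i. a * c i"])
  qed
  moreover have "f ` A \<subseteq> ?R"
  proof
    fix x assume "x \<in> f ` A"
    then obtain k where "k \<in> A" "x = f k" by blast
    then show "x \<in> ?R"
      using assms by (intro range_eqI[of _ _ "\<lambda>i. of_bool (i = k)"]) simp_all
  qed
  ultimately show "ideal_gen (f ` A) \<subseteq> ?R"
    unfolding ideal_gen_def by (intro ring_module.span_minimal)
next
  show "?R \<subseteq> ideal_gen (f ` A)"
    unfolding ideal_gen_def
    by (intro image_subsetI ring_module.span_sum ring_module.span_scale)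
      (simp add: ring_module.span_base)
qed

lemma mem_syzygies_iff:
  "s \<in> syzygies B \<longleftrightarrow> s \<in> carrier_vec (length B) \<and> (\<Sum>j<length B. s $ j * B ! j) = 0"
  by (auto simp: syzygies_def scalar_prod_def vec_of_list_index atLeast0LessThan)

text \<open>Moving all terms of \<open>B ! r * m = (\<Sum>j\<noteq>r. c j * B ! j)\<close> to one side gives a syzygy with
  coordinate \<open>m\<close> at \<open>r\<close> and \<open>- c j\<close> elsewhere, and conversely. Distinctness makes the removal of
  the element \<open>B ! r\<close> from the set agree with the removal of the position \<open>r\<close>.\<close>

lemma mult_mem_others_iff_syzygy_coordinate:
  fixes B :: "'a::comm_ring_1 list"
  assumes "distinct B" "r < length B"
  shows "B ! r * m \<in> ideal_gen (set B - {B ! r}) \<longleftrightarrow> (\<exists>s\<in>syzygies B. s $ r = m)"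
proof -
  let ?J = "{..<length B} - {r}"
  have "set B - {B ! r} = (!) B ` ?J"
    using assms by (auto simp: set_conv_nth nth_eq_iff_index_eq)
  then have gen: "ideal_gen (set B - {B ! r}) = range (\<lambda>c. \<Sum>j\<in>?J. c j * B ! j)"
    by (simp add: ideal_gen_image_finite)
  have split: "(\<Sum>j<length B. s $ j * B ! j) = s $ r * B ! r + (\<Sum>j\<in>?J. s $ j * B ! j)" for s
    using assms(2) by (intro sum.remove) simp_all
  show ?thesis
  proof
    assume "B ! r * m \<in> ideal_gen (set B - {B ! r})"
    then obtain c where c: "B ! r * m = (\<Sum>j\<in>?J. c j * B ! j)" using gen by blast
    define s where "s = vec (length B) (\<lambda>j. if j = r then m else - c j)"
    have "(\<Sum>j\<in>?J. s $ j * B ! j) = - (\<Sum>j\<in>?J. c j * B ! j)"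
      unfolding sum_negf[symmetric] by (rule sum.cong) (simp_all add: s_def)
    then have "s \<in> syzygies B"
      using assms(2) c[symmetric] by (simp add: mem_syzygies_iff split) (simp add: s_def)
    moreover have "s $ r = m"
      using assms(2) by (simp add: s_def)
    ultimately show "\<exists>s\<in>syzygies B. s $ r = m" ..
  next
    assume "\<exists>s\<in>syzygies B. s $ r = m"
    then obtain s where "s \<in> syzygies B" and m: "s $ r = m" by blast
    then have "m * B ! r + (\<Sum>j\<in>?J. s $ j * B ! j) = 0"
      by (simp add: mem_syzygies_iff split)
    then have "B ! r * m = (\<Sum>j\<in>?J. - s $ j * B ! j)"
      by (simp add: sum_negf eq_neg_iff_add_eq_0 mult.commute)
    then show "B ! r * m \<in> ideal_gen (set B - {B ! r})"
      unfolding gen by (rule range_eqI[of _ _ "\<lambda>j. - s $ j"])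
  qed
qed

lemma row_combination_mem_syzygies:
  fixes M :: "'a::comm_ring_1 mat"
  assumes M: "M \<in> carrier_mat k (length B)"
    and rows: "\<forall>i<k. row M i \<in> syzygies B"
    and c: "c \<in> carrier_vec k"
  shows "transpose_mat M *\<^sub>v c \<in> syzygies B"
proof -
  have b: "vec_of_list B \<in> carrier_vec (length B)"
    by (rule carrier_vecI) simp
  \<comment> \<open>The rows are syzygies exactly when the matrix annihilates the vector of generators.\<close>
  have zero: "M *\<^sub>v vec_of_list B = 0\<^sub>v k"
    using M rows by (intro eq_vecI) (auto simp: syzygies_def)
  have "(transpose_mat M *\<^sub>v c) \<bullet> vec_of_list B = c \<bullet> (M *\<^sub>v vec_of_list B)"
    by (rule transpose_vec_mult_scalar[OF M b c])
  also have "\<dots> = 0"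
    using c by (simp add: zero)
  finally show ?thesis
    using M c by (simp add: syzygies_def)
qed

text \<open>The \<open>r\<close>-th coordinate of a linear combination of the rows is the same combination of the
  entries of the \<open>r\<close>-th column, and these combinations are all the syzygies.\<close>

lemma mem_column_ideal_iff_syzygy_coordinate:
  fixes M :: "'a::comm_ring_1 mat"
  assumes M: "M \<in> carrier_mat k (length B)"
    and rows: "\<forall>i<k. row M i \<in> syzygies B"
    and spanning: "\<forall>s\<in>syzygies B. \<exists>c\<in>carrier_vec k. transpose_mat M *\<^sub>v c = s"
    and r: "r < length B"
  shows "m \<in> column_ideal M r \<longleftrightarrow> (\<exists>s\<in>syzygies B. s $ r = m)"
proof -
  have "set\<^sub>v (col M r) = (\<lambda>i. M $$ (i, r)) ` {..<k}"
    using M r by (auto simp: vec_set_def)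
  then have gen: "column_ideal M r = range (\<lambda>c. \<Sum>i<k. c i * M $$ (i, r))"
    by (simp add: column_ideal_def ideal_gen_image_finite)
  have coord: "(transpose_mat M *\<^sub>v c) $ r = (\<Sum>i<k. c $ i * M $$ (i, r))"
    if "c \<in> carrier_vec k" for c
    using M r that by (simp add: scalar_prod_def atLeast0LessThan mult.commute)
  show ?thesis
  proof
    assume "m \<in> column_ideal M r"
    then obtain c where "m = (\<Sum>i<k. c i * M $$ (i, r))" using gen by blast
    then have "(transpose_mat M *\<^sub>v vec k c) $ r = m" by (simp add: coord)
    then show "\<exists>s\<in>syzygies B. s $ r = m"
      using row_combination_mem_syzygies[OF M rows vec_carrier] by blast
  next
    assume "\<exists>s\<in>syzygies B. s $ r = m"
    then obtain s where s: "s \<in> syzygies B" "s $ r = m" ..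
    then obtain c where "c \<in> carrier_vec k" "transpose_mat M *\<^sub>v c = s"
      using spanning by blast
    with s(2) have "m = (\<Sum>i<k. c $ i * M $$ (i, r))"
      using coord[of c] by simp
    then show "m \<in> column_ideal M r"
      unfolding gen by (rule range_eqI[of _ _ "\<lambda>i. c $ i"])
  qed
qed

theorem proposition4p1:
  fixes I :: "('v::finite, 'k::alg_closed_field) mpoly set"
    and B :: "('v, 'k) mpoly list"
    and M :: "('v, 'k) mpoly mat"
    and r :: nat
  assumes "homogeneous_ideal I"
    and "perfect_ideal I"
    and "codimension I = 2"
    and "saturation I \<subset> irrelevant_ideal"
    and "standard_basis I B"
    and "hilbert_matrix B M"
    and "r < length B"
  shows "inessential B (B ! r) \<longleftrightarrow>
    (\<exists>t. ideal_power irrelevant_ideal t \<subseteq> column_ideal M r)"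
proof -
  have "distinct B"
    using assms(5) by (simp add: standard_basis_def)
  have M: "M \<in> carrier_mat (length B - 1) (length B)"
    using assms(6) by (simp add: hilbert_matrix_def)
  have rows: "\<forall>i<length B - 1. row M i \<in> syzygies B"
    using assms(6) M by (auto simp: hilbert_matrix_def)
  have spanning: "\<forall>s\<in>syzygies B. \<exists>c\<in>carrier_vec (length B - 1). transpose_mat M *\<^sub>v c = s"
    using assms(6) M unfolding hilbert_matrix_def by (metis carrier_matD(1))
  have "B ! r * m \<in> ideal_gen (set B - {B ! r}) \<longleftrightarrow> m \<in> column_ideal M r" for m
    using mult_mem_others_iff_syzygy_coordinate[OF \<open>distinct B\<close> assms(7)]
      mem_column_ideal_iff_syzygy_coordinate[OF M rows spanning assms(7)]
    by blast
  then show ?thesis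
    using assms(7) by (auto simp: inessential_def saturation_def)
qed

end
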